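(* For every $n\in\mathbb{N}$ with $n\neq 2,3$: (i) there exists a simplicial complex $X_{2n}$ with $8n-1$ vertices and $\pi_1(X_{2n})\cong\mathbb{Z}^{2n}$; (ii) there exists a simplicial complex $X_{2n-1}$ with $8n-3$ vertices and $\pi_1(X_{2n-1})\cong\mathbb{Z}^{2n-1}$. In particular, for every $m$ there is a simplicial complex on $O(m)$ vertices with fundamental group $\mathbb{Z}^m$.
   Context: Fundamental groups of (possibly disconnected) complexes are taken at a suitable basepoint. *)

theory Defs
  imports "HOL-Analysis.Analysis" "HOL-Algebra.Algebra"
begin

definition simplicial_complex :: "nat set \<Rightarrow> nat set set \<Rightarrow> bool" where
  "simplicial_complex V K \<longleftrightarrow>
     finite V \<and> (\<forall>F\<in>K. F \<noteq> {} \<and> F \<subseteq> V) \<and>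
     (\<forall>F\<in>K. \<forall>G. G \<noteq> {} \<and> G \<subseteq> F \<longrightarrow> G \<in> K) \<and>
     (\<forall>v\<in>V. {v} \<in> K)"

text \<open>Geometric realization: barycentric-coordinate functions whose support is a face.
  It lives in nat => real with the product topology (which on this finite complex
  agrees with the usual topology of the realization).\<close>
definition geometric_realization :: "nat set set \<Rightarrow> (nat \<Rightarrow> real) set" where
  "geometric_realization K =
     {f. (\<forall>i. 0 \<le> f i) \<and> {i. f i \<noteq> 0} \<in> K \<and> sum f {i. f i \<noteq> 0} = 1}"

definition fundamental_group :: "'a::topological_space set \<Rightarrow> 'a \<Rightarrow> (real \<Rightarrow> 'a) set monoid" where
  "fundamental_group S x0 =
     \<lparr>carrier = {{q. homotopic_paths S p q} | p.
                   path p \<and> path_image p \<subseteq> S \<and> pathstart p = x0 \<and> pathfinish p = x0},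
      mult = (\<lambda>A B. {r. \<exists>p\<in>A. \<exists>q\<in>B. homotopic_paths S (p +++ q) r}),
      one = {q. homotopic_paths S (\<lambda>_. x0) q}\<rparr>"

definition Zpow :: "nat \<Rightarrow> (nat \<Rightarrow> int) monoid" where
  "Zpow m = product_group {..<m} (\<lambda>_. integer_group)"

definition has_complex_with_pi1_Zpow :: "nat \<Rightarrow> nat \<Rightarrow> bool" where
  "has_complex_with_pi1_Zpow N m \<longleftrightarrow>
     (\<exists>V K x0. simplicial_complex V K \<and> card V = N \<and> x0 \<in> geometric_realization K \<and>
        fundamental_group (geometric_realization K) x0 \<cong> Zpow m)"

end

theory Submission
  imports Defs "HOL-Complex_Analysis.Winding_Numbers" "HOL-Number_Theory.Cong"
begin

text \<open>
  Every generator of \<open>\<int>\<^sup>m\<close> is a triangle through a base vertex, and every pair of generators is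
  made to commute by a seven-vertex torus containing their two triangles; this uses two further
  vertices per pair.  Colour the edges of the complete graph on the generators properly and let all
  pairs of one colour share their two vertices.  In the seven-vertex torus these two vertices can be
  chosen to span a face with the base vertex, so two tori meet in the base vertex, in one such
  triangle, or in the triangle of a common generator, and nothing else is identified.

  Loops are homotopic to edge paths, and the star of the base vertex is a spanning tree, so the
  tori show that the group is abelian and generated by the m triangles.  The dual integral
  cocycles give maps to the circle, and winding numbers show that the generators are independent.
\<close>

section \<open>The fundamental group\<close>

text \<open>The vertex count is 1 for the base, 2 per generator and 2 per colour. Fresh vertices for
  each pair would make it quadratic in m. A complete graph on m vertices can be coloured with m
  colours, and with m - 1 when m is even and positive, so the count becomes 4m + 1 or 4m - 1; for m
  = 2n - 1 and m = 2n these are 8n - 3 and 8n - 1.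

  No van Kampen argument computes the group of the union. The tori bound it from above, as a
  quotient of Z^m, and the cocycles bound it from below, as m homomorphisms to the integers dual to
  the generators. That the gluing creates no further relation enters only through the existence of
  these cocycles: each must have a single value on every edge that several tori share.\<close>

definition path_class :: "'a::topological_space set \<Rightarrow> (real \<Rightarrow> 'a) \<Rightarrow> (real \<Rightarrow> 'a) set" where
  "path_class S p = {q. homotopic_paths S p q}"

section \<open>Homotopies obtained by reparametrization\<close>

lemma homotopic_paths_reparam:
  fixes p :: "real \<Rightarrow> 'a::topological_space"
  assumes "path p" "path_image p \<subseteq> S" "path f" "path g"
    and "path_image f \<subseteq> {0..1}" "path_image g \<subseteq> {0..1}"
    and "pathstart f = pathstart g" "pathfinish f = pathfinish g"
  shows "homotopic_paths S (p \<circ> f) (p \<circ> g)"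
proof (rule homotopic_paths_continuous_image)
  show "homotopic_paths {0..1} f g"
  proof (rule homotopic_paths_linear)
    show "closed_segment (f t) (g t) \<subseteq> {0..1}" if "t \<in> {0..1}" for t
      by (rule closed_segment_subset) (use that assms(5,6) in \<open>auto simp: path_image_def image_subset_iff\<close>)
  qed (use assms in auto)
  show "continuous_on {0..1} p" "p \<in> {0..1} \<rightarrow> S"
    using assms(1,2) by (auto simp: path_def path_image_def)
qed

text \<open>Identity, reversal and constant paths appear as linear reparametrizations of
  \<open>p\<close>, so the unit and inverse laws reduce to convexity of [0,1] and hold in every
  topological space.\<close>

lemma comp_linepath:
  fixes p :: "real \<Rightarrow> 'a::topological_space"
  shows "p \<circ> linepath 0 1 = p" "p \<circ> linepath 1 0 = reversepath p" "p \<circ> linepath a a = (\<lambda>_. p a)"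
  by (auto simp: fun_eq_iff linepath_def reversepath_def algebra_simps)

lemma homotopic_paths_const_left:
  assumes "path p" "path_image p \<subseteq> S" "x = pathstart p"
  shows "homotopic_paths S ((\<lambda>_. x) +++ p) p"
proof -
  have "homotopic_paths S (p \<circ> (linepath 0 0 +++ linepath 0 1)) (p \<circ> linepath 0 1)"
    using assms by (intro homotopic_paths_reparam) (auto simp: path_image_join closed_segment_eq_real_ivl)
  then show ?thesis
    using assms by (simp add: path_compose_join comp_linepath pathstart_def)
qed

lemma homotopic_paths_const_right:
  assumes "path p" "path_image p \<subseteq> S" "x = pathfinish p"
  shows "homotopic_paths S (p +++ (\<lambda>_. x)) p"
proof -
  have "homotopic_paths S (p \<circ> (linepath 0 1 +++ linepath 1 1)) (p \<circ> linepath 0 1)"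
    using assms by (intro homotopic_paths_reparam) (auto simp: path_image_join closed_segment_eq_real_ivl)
  then show ?thesis
    using assms by (simp add: path_compose_join comp_linepath pathfinish_def)
qed

lemma homotopic_paths_reverse_left:
  assumes "path p" "path_image p \<subseteq> S"
  shows "homotopic_paths S (reversepath p +++ p) (\<lambda>_. pathfinish p)"
proof -
  have "homotopic_paths S (p \<circ> (linepath 1 0 +++ linepath 0 1)) (p \<circ> linepath 1 1)"
    using assms by (intro homotopic_paths_reparam) (auto simp: path_image_join closed_segment_eq_real_ivl)
  then show ?thesis
    using assms by (simp add: path_compose_join comp_linepath pathfinish_def)
qed

lemma homotopic_paths_join_subpaths:
  fixes p :: "real \<Rightarrow> 'a::topological_space"
  assumes "path p" "path_image p \<subseteq> S" "u \<in> {0..1}" "v \<in> {0..1}" "w \<in> {0..1}"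
  shows "homotopic_paths S ((p \<circ> linepath u v) +++ (p \<circ> linepath v w)) (p \<circ> linepath u w)"
proof -
  have "homotopic_paths S (p \<circ> (linepath u v +++ linepath v w)) (p \<circ> linepath u w)"
    using assms
    by (intro homotopic_paths_reparam) (auto simp: path_image_join closed_segment_eq_real_ivl split: if_splits)
  then show ?thesis
    by (simp add: path_compose_join)
qed

section \<open>The group structure on classes of loops\<close>

definition loop_in :: "'a::topological_space set \<Rightarrow> 'a \<Rightarrow> (real \<Rightarrow> 'a) \<Rightarrow> bool" where
  "loop_in S x p \<longleftrightarrow> path p \<and> path_image p \<subseteq> S \<and> pathstart p = x \<and> pathfinish p = x"

lemma loop_in_join: "loop_in S x p \<Longrightarrow> loop_in S x q \<Longrightarrow> loop_in S x (p +++ q)"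
  by (auto simp: loop_in_def path_image_join)

lemma loop_in_reverse: "loop_in S x p \<Longrightarrow> loop_in S x (reversepath p)"
  by (auto simp: loop_in_def)

lemma loop_in_const: "x \<in> S \<Longrightarrow> loop_in S x (\<lambda>_. x)"
  by (auto simp: loop_in_def path_def path_image_def pathstart_def pathfinish_def)

lemma path_class_eq_iff:
  assumes "path p" "path_image p \<subseteq> S"
  shows "path_class S p = path_class S q \<longleftrightarrow> homotopic_paths S p q"
proof
  assume "path_class S p = path_class S q"
  then have "p \<in> path_class S q"
    using assms unfolding path_class_def by fastforce
  then show "homotopic_paths S p q"
    by (simp add: path_class_def homotopic_paths_sym)
next
  assume "homotopic_paths S p q"
  then show "path_class S p = path_class S q"
    unfolding path_class_def by (blast intro: homotopic_paths_trans homotopic_paths_sym)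
qed

lemma path_class_cong: "homotopic_paths S p q \<Longrightarrow> path_class S p = path_class S q"
  using homotopic_paths_imp_path[of S p q] homotopic_paths_imp_subset[of S p q] path_class_eq_iff[of p S q]
  by simp

lemma carrier_fundamental_group:
  "carrier (fundamental_group S x) = path_class S ` {p. loop_in S x p}"
  by (auto simp: fundamental_group_def path_class_def loop_in_def)

lemma one_fundamental_group: "\<one>\<^bsub>fundamental_group S x\<^esub> = path_class S (\<lambda>_. x)"
  by (auto simp: fundamental_group_def path_class_def)

text \<open>The product of classes runs over all representatives at once; homotopy invariance of
  concatenation collapses it to one class.\<close>

lemma mult_fundamental_group:
  assumes "loop_in S x p" "loop_in S x q"
  shows "path_class S p \<otimes>\<^bsub>fundamental_group S x\<^esub> path_class S q = path_class S (p +++ q)"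
proof -
  have "homotopic_paths S (p +++ q) r \<longleftrightarrow>
      (\<exists>p'. homotopic_paths S p p' \<and> (\<exists>q'. homotopic_paths S q q' \<and> homotopic_paths S (p' +++ q') r))" for r
  proof
    assume "homotopic_paths S (p +++ q) r"
    then show "\<exists>p'. homotopic_paths S p p' \<and> (\<exists>q'. homotopic_paths S q q' \<and> homotopic_paths S (p' +++ q') r)"
      using assms by (intro exI[of _ p] conjI exI[of _ q]) (auto simp: loop_in_def)
  next
    assume "\<exists>p'. homotopic_paths S p p' \<and> (\<exists>q'. homotopic_paths S q q' \<and> homotopic_paths S (p' +++ q') r)"
    then obtain p' q' where "homotopic_paths S p p'" "homotopic_paths S q q'" "homotopic_paths S (p' +++ q') r"
      by auto
    then show "homotopic_paths S (p +++ q) r"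
      using assms by (metis homotopic_paths_join homotopic_paths_trans loop_in_def)
  qed
  then show ?thesis
    by (auto simp: fundamental_group_def path_class_def)
qed

lemma group_fundamental_group:
  assumes "x \<in> S"
  shows "group (fundamental_group S x)"
proof (rule groupI)
  let ?G = "fundamental_group S x"
  show "a \<otimes>\<^bsub>?G\<^esub> b \<in> carrier ?G" if "a \<in> carrier ?G" "b \<in> carrier ?G" for a b
    using that by (auto simp: carrier_fundamental_group mult_fundamental_group intro!: loop_in_join)
  show "\<one>\<^bsub>?G\<^esub> \<in> carrier ?G"
    using loop_in_const[OF assms] by (auto simp: carrier_fundamental_group one_fundamental_group)
  show "a \<otimes>\<^bsub>?G\<^esub> b \<otimes>\<^bsub>?G\<^esub> c = a \<otimes>\<^bsub>?G\<^esub> (b \<otimes>\<^bsub>?G\<^esub> c)"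
    if abc: "a \<in> carrier ?G" "b \<in> carrier ?G" "c \<in> carrier ?G" for a b c
  proof -
    obtain p q r where pqr: "loop_in S x p" "loop_in S x q" "loop_in S x r"
      "a = path_class S p" "b = path_class S q" "c = path_class S r"
      using abc by (auto simp: carrier_fundamental_group)
    moreover have "path_class S ((p +++ q) +++ r) = path_class S (p +++ (q +++ r))"
      using pqr by (intro path_class_cong homotopic_paths_sym[OF homotopic_paths_assoc]) (auto simp: loop_in_def)
    ultimately show ?thesis
      by (simp add: mult_fundamental_group loop_in_join)
  qed
  show "\<one>\<^bsub>?G\<^esub> \<otimes>\<^bsub>?G\<^esub> a = a" if a: "a \<in> carrier ?G" for a
  proof -
    obtain p where p: "loop_in S x p" "a = path_class S p"
      using a by (auto simp: carrier_fundamental_group)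
    then have "path_class S ((\<lambda>_. x) +++ p) = path_class S p"
      by (intro path_class_cong homotopic_paths_const_left) (auto simp: loop_in_def)
    then show ?thesis
      using p by (simp add: one_fundamental_group mult_fundamental_group loop_in_const assms)
  qed
  show "\<exists>b\<in>carrier ?G. b \<otimes>\<^bsub>?G\<^esub> a = \<one>\<^bsub>?G\<^esub>" if a: "a \<in> carrier ?G" for a
  proof -
    obtain p where p: "loop_in S x p" "a = path_class S p"
      using a by (auto simp: carrier_fundamental_group)
    then have "path_class S (reversepath p +++ p) = path_class S (\<lambda>_. x)"
      using homotopic_paths_reverse_left[of p S] by (intro path_class_cong) (auto simp: loop_in_def)
    then show ?thesis
      using p loop_in_reverse[OF p(1)]
      by (auto simp: one_fundamental_group mult_fundamental_group carrier_fundamental_group intro!: bexI[of _ "path_class S (reversepath p)"])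
  qed
qed

text \<open>Cancels a detour \<open>b\<close> against its reverse. It serves twice: to splice pieces
  of a subdivided path at a vertex, and to multiply loops that return to the root along the
  tree.\<close>

lemma homotopic_paths_bridge:
  assumes hom: "homotopic_paths S (p +++ q) r"
    and paths: "path a" "path p" "path b" "path q" "path c"
    and sub: "path_image a \<subseteq> S" "path_image p \<subseteq> S" "path_image b \<subseteq> S" "path_image q \<subseteq> S" "path_image c \<subseteq> S"
    and ends: "pathfinish a = pathstart p" "pathfinish p = pathstart q" "pathfinish p = pathstart b" "pathfinish q = pathstart c"
  shows "homotopic_paths S ((a +++ (p +++ b)) +++ (reversepath b +++ (q +++ c))) (a +++ (r +++ c))"
proof -
  note [simp] = paths sub ends(1,4) path_image_join
  have eqs: "pathstart r = pathstart p" "pathfinish r = pathfinish q" "path r" "path_image r \<subseteq> S"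
    using hom homotopic_paths_imp_pathstart homotopic_paths_imp_pathfinish homotopic_paths_imp_path
      homotopic_paths_imp_subset by (fastforce, fastforce, blast, blast)
  note [simp] = eqs ends(2)[symmetric] ends(3)[symmetric]
  let ?k = "\<lambda>_::real. pathfinish p"
  have k [simp]: "path ?k" "path_image ?k \<subseteq> S" "pathstart ?k = pathfinish p" "pathfinish ?k = pathfinish p"
    using sub(2) pathfinish_in_path_image[of p] by (auto simp: path_def path_image_def pathstart_def pathfinish_def)
  have "homotopic_paths S ((a +++ (p +++ b)) +++ (reversepath b +++ (q +++ c)))
      (a +++ ((p +++ b) +++ (reversepath b +++ (q +++ c))))"
    by (rule homotopic_paths_sym[OF homotopic_paths_assoc]) auto
  also have "homotopic_paths S \<dots> (a +++ (p +++ (b +++ (reversepath b +++ (q +++ c)))))"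
    by (intro homotopic_paths_join homotopic_paths_sym[OF homotopic_paths_assoc]) auto
  also have "homotopic_paths S \<dots> (a +++ (p +++ ((b +++ reversepath b) +++ (q +++ c))))"
    by (intro homotopic_paths_join homotopic_paths_assoc) auto
  also have "homotopic_paths S \<dots> (a +++ (p +++ (?k +++ (q +++ c))))"
    using homotopic_paths_reverse_left[of "reversepath b" S] by (intro homotopic_paths_join) auto
  also have "homotopic_paths S \<dots> (a +++ (p +++ (q +++ c)))"
    by (intro homotopic_paths_join homotopic_paths_const_left) auto
  also have "homotopic_paths S \<dots> (a +++ ((p +++ q) +++ c))"
    by (intro homotopic_paths_join homotopic_paths_assoc) auto
  also have "homotopic_paths S \<dots> (a +++ (r +++ c))"
    using hom by (intro homotopic_paths_join) auto
  finally show ?thesis .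
qed

lemma path_restrict:
  fixes p :: "real \<Rightarrow> 'a::topological_space"
  assumes p: "path p" "path_image p \<subseteq> S" and st: "s \<in> {0..1}" "t \<in> {0..1}"
  shows "path (p \<circ> linepath s t)" "path_image (p \<circ> linepath s t) \<subseteq> S"
proof -
  have "closed_segment s t \<subseteq> {0..1}"
    using st by (auto simp: closed_segment_eq_real_ivl)
  then have *: "linepath s t ` {0..1} \<subseteq> {0..1}"
    using path_image_linepath[of s t] unfolding path_image_def by auto
  have "continuous_on (linepath s t ` {0..1}) p"
    using p(1) * unfolding path_def by (rule continuous_on_subset)
  then show "path (p \<circ> linepath s t)"
    unfolding path_def by (intro continuous_on_compose continuous_on_linepath)
  show "path_image (p \<circ> linepath s t) \<subseteq> S"
    using * p(2) unfolding path_image_def by auto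
qed

section \<open>Edge paths in a simplicial complex\<close>

definition supp :: "(nat \<Rightarrow> real) \<Rightarrow> nat set" where
  "supp x = {i. x i \<noteq> 0}"

definition vertex_point :: "nat \<Rightarrow> nat \<Rightarrow> real" where
  "vertex_point v = (\<lambda>i. if i = v then 1 else 0)"

definition segment :: "(nat \<Rightarrow> real) \<Rightarrow> (nat \<Rightarrow> real) \<Rightarrow> real \<Rightarrow> nat \<Rightarrow> real" where
  "segment x y = (\<lambda>t i. (1 - t) * x i + t * y i)"

lemma supp_vertex_point [simp]: "supp (vertex_point v) = {v}"
  by (auto simp: supp_def vertex_point_def)

lemma supp_segment_subset: "supp (segment x y t) \<subseteq> supp x \<union> supp y"
  by (auto simp: supp_def segment_def)

lemma segment_simps [simp]:
  "segment x x = (\<lambda>_. x)" "pathstart (segment x y) = x" "pathfinish (segment x y) = y"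
  "reversepath (segment x y) = segment y x" "segment x y 0 = x" "segment x y 1 = y"
  by (auto simp: segment_def pathstart_def pathfinish_def reversepath_def fun_eq_iff algebra_simps)

lemma path_segment [simp]: "path (segment x y)"
  unfolding path_def segment_def by (intro continuous_intros)

locale finite_complex =
  fixes V :: "nat set" and K :: "nat set set"
  assumes complex: "simplicial_complex V K"
begin

abbreviation "S \<equiv> geometric_realization K"

lemma finite_V: "finite V" and face_subset: "F \<in> K \<Longrightarrow> F \<subseteq> V"
  and face_nonempty: "F \<in> K \<Longrightarrow> F \<noteq> {}"
  and face_down: "F \<in> K \<Longrightarrow> G \<noteq> {} \<Longrightarrow> G \<subseteq> F \<Longrightarrow> G \<in> K"
  and vertex_face: "v \<in> V \<Longrightarrow> {v} \<in> K"
  using complex unfolding simplicial_complex_def by blast+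

lemma edge_vertices: "{u, v} \<in> K \<Longrightarrow> u \<in> V \<and> v \<in> V"
  using face_subset by blast

text \<open>Summing over all of \<open>V\<close> makes the normalization linear in \<open>x\<close>,
  and a face bounding the supports still bounds those of convex combinations. Hence a segment
  between two points of one closed simplex stays in the realization.\<close>

lemma mem_realization_iff:
  "x \<in> S \<longleftrightarrow> (\<forall>i. 0 \<le> x i) \<and> (\<exists>F\<in>K. supp x \<subseteq> F) \<and> sum x V = 1"
proof -
  have "sum x {i. x i \<noteq> 0} = sum x V" if "{i. x i \<noteq> 0} \<subseteq> V"
    using that by (intro sum.mono_neutral_left finite_V) auto
  moreover have "{i. x i \<noteq> 0} \<noteq> {}" if "sum x V = 1"
    using that by (metis (mono_tags, lifting) empty_Collect_eq sum.neutral zero_neq_one)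
  ultimately have sum: "{i. x i \<noteq> 0} \<subseteq> V \<Longrightarrow> sum x {i. x i \<noteq> 0} = sum x V" "sum x V = 1 \<Longrightarrow> {i. x i \<noteq> 0} \<noteq> {}"
    by blast+
  show ?thesis
  proof
    assume "x \<in> S"
    then have x: "\<forall>i. 0 \<le> x i" "supp x \<in> K" "sum x (supp x) = 1"
      by (auto simp: geometric_realization_def supp_def)
    then show "(\<forall>i. 0 \<le> x i) \<and> (\<exists>F\<in>K. supp x \<subseteq> F) \<and> sum x V = 1"
      using sum(1) face_subset[of "supp x"] by (auto simp: supp_def)
  next
    assume "(\<forall>i. 0 \<le> x i) \<and> (\<exists>F\<in>K. supp x \<subseteq> F) \<and> sum x V = 1"
    then obtain F where x: "\<forall>i. 0 \<le> x i" "F \<in> K" "supp x \<subseteq> F" "sum x V = 1"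
      by blast
    then have "supp x \<in> K"
      using sum(2) face_down[of F "supp x"] by (auto simp: supp_def)
    then show "x \<in> S"
      using x sum(1) face_subset[of "supp x"] by (auto simp: geometric_realization_def supp_def)
  qed
qed

lemma support_face: "x \<in> S \<Longrightarrow> supp x \<in> K"
  by (simp add: geometric_realization_def supp_def)

lemma vertex_point_in: "v \<in> V \<Longrightarrow> vertex_point v \<in> S"
  using finite_V vertex_face[of v] unfolding mem_realization_iff
  by (auto simp: supp_vertex_point) (auto simp: vertex_point_def)

lemma segment_in:
  assumes "x \<in> S" "y \<in> S" "F \<in> K" "supp x \<union> supp y \<subseteq> F" "t \<in> {0..1}"
  shows "segment x y t \<in> S"
  unfolding mem_realization_iff
proof (intro conjI allI)
  show "0 \<le> segment x y t i" for i
    using assms by (auto simp: segment_def mem_realization_iff)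
  show "\<exists>F\<in>K. supp (segment x y t) \<subseteq> F"
    using assms(3,4) supp_segment_subset by blast
  have "sum (segment x y t) V = (1 - t) * sum x V + t * sum y V"
    by (simp add: segment_def sum.distrib sum_distrib_left)
  then show "sum (segment x y t) V = 1"
    using assms by (auto simp: mem_realization_iff)
qed

lemma path_image_segment:
  assumes "x \<in> S" "y \<in> S" "F \<in> K" "supp x \<union> supp y \<subseteq> F"
  shows "path_image (segment x y) \<subseteq> S"
  unfolding path_image_def using segment_in[OF assms] by blast

section \<open>Contiguous paths\<close>

definition contiguous :: "(real \<Rightarrow> nat \<Rightarrow> real) \<Rightarrow> (real \<Rightarrow> nat \<Rightarrow> real) \<Rightarrow> bool" where
  "contiguous p q \<longleftrightarrow> (\<forall>t\<in>{0..1}. \<exists>F\<in>K. supp (p t) \<union> supp (q t) \<subseteq> F)"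

lemma contiguous_join:
  assumes "contiguous p q" "contiguous p' q'"
  shows "contiguous (p +++ p') (q +++ q')"
  unfolding contiguous_def
proof
  fix t :: real
  assume t: "t \<in> {0..1}"
  show "\<exists>F\<in>K. supp ((p +++ p') t) \<union> supp ((q +++ q') t) \<subseteq> F"
  proof (cases "t \<le> 1/2")
    case True
    then show ?thesis
      using assms(1) t unfolding contiguous_def joinpaths_def by (auto dest!: bspec[of _ _ "2 * t"])
  next
    case False
    then show ?thesis
      using assms(2) t unfolding contiguous_def joinpaths_def by (auto dest!: bspec[of _ _ "2 * t - 1"])
  qed
qed

lemma contiguous_segments:
  assumes "F \<in> K" "supp x \<union> supp y \<union> supp x' \<union> supp y' \<subseteq> F"
  shows "contiguous (segment x y) (segment x' y')"
  unfolding contiguous_def using assms supp_segment_subset by (meson Un_least le_sup_iff order_trans)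

text \<open>At each time the straight-line homotopy moves inside a simplex containing both points,
  so it never leaves the realization.\<close>

lemma homotopic_contiguous:
  assumes pq: "path p" "path_image p \<subseteq> S" "path q" "path_image q \<subseteq> S"
    and ends: "pathstart p = pathstart q" "pathfinish p = pathfinish q"
    and cont: "contiguous p q"
  shows "homotopic_paths S p q"
  unfolding homotopic_paths
proof (intro exI conjI)
  let ?h = "\<lambda>z. segment (p (snd z)) (q (snd z)) (fst z)"
  have c: "continuous_on {0..1} (\<lambda>t. p t i)" "continuous_on {0..1} (\<lambda>t. q t i)" for i
    using pq unfolding path_def by (auto intro: continuous_on_product_then_coordinatewise)
  show "continuous_on ({0..1} \<times> {0..1}) ?h"
    unfolding segment_def
    by (intro continuous_intros continuous_on_compose2[OF c(1)] continuous_on_compose2[OF c(2)]) auto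
  have "segment (p t) (q t) s \<in> S" if st: "s \<in> {0..1}" "t \<in> {0..1}" for s t
  proof -
    obtain F where "F \<in> K" "supp (p t) \<union> supp (q t) \<subseteq> F"
      using cont st unfolding contiguous_def by blast
    moreover have "p t \<in> S" "q t \<in> S"
      using pq st by (auto simp: path_image_def)
    ultimately show ?thesis
      using segment_in st by blast
  qed
  then show "?h \<in> {0..1} \<times> {0..1} \<rightarrow> S"
    by auto
qed (use ends in \<open>auto simp: pathstart_def pathfinish_def\<close>)

section \<open>Approximation of paths by edge paths\<close>

abbreviation edge :: "nat \<Rightarrow> nat \<Rightarrow> real \<Rightarrow> nat \<Rightarrow> real" where
  "edge u v \<equiv> segment (vertex_point u) (vertex_point v)"

lemma path_image_edge: "{u, v} \<in> K \<Longrightarrow> path_image (edge u v) \<subseteq> S"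
  using edge_vertices by (intro path_image_segment vertex_point_in) auto

text \<open>Closure under homotopy makes this a property of homotopy classes: some concatenation of
  edges represents the class. Invariants then follow by rule induction, without vertex
  sequences.\<close>

inductive edge_path :: "nat \<Rightarrow> nat \<Rightarrow> (real \<Rightarrow> nat \<Rightarrow> real) \<Rightarrow> bool" where
  edge: "{u, v} \<in> K \<Longrightarrow> edge_path u v (edge u v)"
| join: "edge_path u v p \<Longrightarrow> edge_path v w q \<Longrightarrow> edge_path u w (p +++ q)"
| homotopic: "edge_path u v p \<Longrightarrow> homotopic_paths S p q \<Longrightarrow> edge_path u v q"

lemma edge_path_imp:
  "edge_path u v p \<Longrightarrow> path p \<and> path_image p \<subseteq> S \<and> pathstart p = vertex_point u \<and>
     pathfinish p = vertex_point v \<and> u \<in> V \<and> v \<in> V"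
proof (induction rule: edge_path.induct)
  case (edge u v)
  then show ?case using path_image_edge edge_vertices by auto
next
  case (join u v p w q)
  then show ?case by (auto simp: path_image_join)
next
  case (homotopic u v p q)
  then show ?case
    using homotopic_paths_imp_path homotopic_paths_imp_subset homotopic_paths_imp_pathstart
      homotopic_paths_imp_pathfinish by metis
qed

text \<open>The subpath stays in the open star of \<open>v\<close>, so it is contiguous to the
  constant path at \<open>v\<close>, and the segments at its ends are contiguous to edges from
  \<open>u\<close> to \<open>v\<close> and from \<open>v\<close> to \<open>w\<close>.\<close>

lemma path_into_star:
  assumes p: "path p" "path_image p \<subseteq> S" "a \<in> {0..1}" "b \<in> {0..1}" "a \<le> b"
    and v: "\<And>t. a \<le> t \<Longrightarrow> t \<le> b \<Longrightarrow> 0 < p t v"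
    and u: "u \<in> supp (p a)" and w: "w \<in> supp (p b)"
  shows "edge_path u w (segment (vertex_point u) (p a) +++
    ((p \<circ> linepath a b) +++ segment (p b) (vertex_point w)))"
proof -
  have pS: "p t \<in> S" if "t \<in> {0..1}" for t
    using p that by (auto simp: path_image_def)
  have S: "p a \<in> S" "p b \<in> S" and va: "v \<in> supp (p a)" and vb: "v \<in> supp (p b)"
    using p(3-5) pS v[of a] v[of b] by (auto simp: supp_def)
  have K: "{u, v} \<in> K" "{v, w} \<in> K" "{v} \<in> K"
    using face_down[OF support_face[OF S(1)]] face_down[OF support_face[OF S(2)]] u w va vb by auto
  have V: "u \<in> V" "v \<in> V" "w \<in> V"
    using K edge_vertices by auto
  have ab: "linepath a b t \<in> {a..b}" if "t \<in> {0..1}" for t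
    using linepath_in_path[of t a b] that p(5) by (simp add: closed_segment_eq_real_ivl)
  let ?p = "p \<circ> linepath a b"
  have pab: "path ?p" "path_image ?p \<subseteq> S" "pathstart ?p = p a" "pathfinish ?p = p b"
    using path_restrict[OF p(1,2,3,4)] by (auto simp: pathstart_def pathfinish_def linepath_def)
  have "contiguous ?p (segment (vertex_point v) (vertex_point v))"
    unfolding contiguous_def
  proof
    fix t :: real assume t: "t \<in> {0..1}"
    have "p (linepath a b t) \<in> S" "0 < p (linepath a b t) v"
      using ab[OF t] p pS v by auto
    then show "\<exists>F\<in>K. supp (?p t) \<union> supp (segment (vertex_point v) (vertex_point v) t) \<subseteq> F"
      using support_face by (intro bexI[of _ "supp (p (linepath a b t))"]) (auto simp: supp_def vertex_point_def)
  qed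
  moreover have "contiguous (segment (vertex_point u) (p a)) (edge u v)"
    using u va S by (intro contiguous_segments[OF support_face[OF S(1)]]) auto
  moreover have "contiguous (segment (p b) (vertex_point w)) (edge v w)"
    using w vb S by (intro contiguous_segments[OF support_face[OF S(2)]]) auto
  ultimately have cont: "contiguous (segment (vertex_point u) (p a) +++ (?p +++ segment (p b) (vertex_point w)))
      (edge u v +++ (edge v v +++ edge v w))" (is "contiguous ?q ?r")
    by (intro contiguous_join)
  have seg: "path_image (segment (vertex_point u) (p a)) \<subseteq> S" "path_image (segment (p b) (vertex_point w)) \<subseteq> S"
    using u w V S
    by (intro path_image_segment[OF _ _ support_face[OF S(1)]] path_image_segment[OF _ _ support_face[OF S(2)]] vertex_point_in; auto)+
  have r: "edge_path u w ?r"
    by (rule edge_path.join[OF edge_path.edge edge_path.join[OF edge_path.edge edge_path.edge]]) (use K in auto)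
  have "homotopic_paths S ?q ?r"
  proof (rule homotopic_contiguous[OF _ _ _ _ _ _ cont])
    show "path ?q"
      using pab by (intro path_join_imp path_segment) (simp_all del: segment_simps(1))
    show "path_image ?q \<subseteq> S"
      using pab seg by (intro subset_path_image_join) 
  qed (use edge_path_imp[OF r] in auto)
  then show ?thesis
    by (rule edge_path.homotopic[OF r homotopic_paths_sym])
qed

text \<open>Bisection replaces a Lebesgue number: short intervals are mapped into an open star by
  continuity of one coordinate, and adjacent intervals are spliced at a vertex in the support of
  their common point.\<close>

lemma path_homotopic_edge_path:
  assumes p: "path p" "path_image p \<subseteq> S" and u: "u \<in> supp (p 0)" and w: "w \<in> supp (p 1)"
  shows "edge_path u w (segment (vertex_point u) (p 0) +++
    ((p \<circ> linepath 0 1) +++ segment (p 1) (vertex_point w)))"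
proof -
  \<comment> \<open>The guards make \<open>P\<close> vacuous on intervals leaving [0,1], which the
    local case also has to treat. Quantifying over all \<open>u\<close> and \<open>w\<close> lets
    both halves use the same vertex at their common end.\<close>
  define P where "P a b \<longleftrightarrow> (0 \<le> a \<longrightarrow> a \<le> b \<longrightarrow> b \<le> 1 \<longrightarrow> (\<forall>u\<in>supp (p a). \<forall>w\<in>supp (p b).
      edge_path u w (segment (vertex_point u) (p a) +++
        ((p \<circ> linepath a b) +++ segment (p b) (vertex_point w)))))" for a b
  have pS: "p t \<in> S" if "t \<in> {0..1}" for t
    using p that by (auto simp: path_image_def)
  from zero_le_one have "P 0 1"
  proof (induction rule: Bolzano)
    case (trans a b c)
    show ?case unfolding P_def
    proof (intro impI ballI)
      fix u w
      assume ac: "0 \<le> a" "a \<le> c" "c \<le> 1" and u: "u \<in> supp (p a)" and w: "w \<in> supp (p c)"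
      then have abc: "a \<in> {0..1}" "b \<in> {0..1}" "c \<in> {0..1}"
        using trans by auto
      obtain v where v: "v \<in> supp (p b)"
        using face_nonempty[OF support_face[OF pS[OF abc(2)]]] by blast
      have 1: "edge_path u v (segment (vertex_point u) (p a) +++
        ((p \<circ> linepath a b) +++ segment (p b) (vertex_point v)))"
       and 2: "edge_path v w (segment (vertex_point v) (p b) +++
        ((p \<circ> linepath b c) +++ segment (p c) (vertex_point w)))"
        using trans abc u v w unfolding P_def by auto
      have V: "u \<in> V" "v \<in> V" "w \<in> V"
        using edge_path_imp[OF 1] edge_path_imp[OF 2] by auto
      note pl = path_restrict[OF p]
      have e: "pathstart (p \<circ> linepath s t) = p s" "pathfinish (p \<circ> linepath s t) = p t" for s t
        by (auto simp: pathstart_def pathfinish_def linepath_def)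
      have seg: "path_image (segment (vertex_point x) (p t)) \<subseteq> S" "path_image (segment (p t) (vertex_point x)) \<subseteq> S"
        if "t \<in> {0..1}" "x \<in> supp (p t)" for x t
        using that support_face[OF pS[OF that(1)]] pS face_subset
        by (intro path_image_segment[of _ _ "supp (p t)"] vertex_point_in; force)+
      have "homotopic_paths S ((segment (vertex_point u) (p a) +++
        ((p \<circ> linepath a b) +++ segment (p b) (vertex_point v))) +++ 
         (reversepath (segment (p b) (vertex_point v)) +++
        ((p \<circ> linepath b c) +++ segment (p c) (vertex_point w))))
        (segment (vertex_point u) (p a) +++ ((p \<circ> linepath a c) +++ segment (p c) (vertex_point w)))"
        using abc pl seg u v w
        by (intro homotopic_paths_bridge homotopic_paths_join_subpaths[OF p]) (simp_all add: e)
      then show "edge_path u w (segment (vertex_point u) (p a) +++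
        ((p \<circ> linepath a c) +++ segment (p c) (vertex_point w)))"
        using edge_path.homotopic[OF edge_path.join[OF 1 2]] by simp
    qed
  next
    case (local \<tau>)
    then have \<tau>: "\<tau> \<in> {0..1}"
      by auto
    obtain v where "v \<in> supp (p \<tau>)"
      using face_nonempty[OF support_face[OF pS[OF \<tau>]]] by blast
    then have v: "0 < p \<tau> v"
      using pS[OF \<tau>] unfolding mem_realization_iff supp_def by (metis less_eq_real_def mem_Collect_eq)
    have "continuous_on {0..1} (\<lambda>t. p t v)"
      using p(1) unfolding path_def by (rule continuous_on_product_then_coordinatewise)
    then obtain d where d: "d > 0" "\<And>t. t \<in> {0..1} \<Longrightarrow> dist t \<tau> < d \<Longrightarrow> dist (p t v) (p \<tau> v) < p \<tau> v"
      using \<tau> v unfolding continuous_on_iff by metis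
    have pos: "0 < p t v" if "t \<in> {0..1}" "\<bar>t - \<tau>\<bar> < d" for t
      using d(2)[OF that(1)] that(2) by (auto simp: dist_real_def)
    show ?case
    proof (intro exI[of _ d] conjI allI impI d(1))
      fix a b assume "a \<le> \<tau> \<and> \<tau> \<le> b \<and> b - a < d"
      then show "P a b"
        unfolding P_def using pos by (intro impI ballI path_into_star[OF p, where v = v]) auto
    qed
  qed
  then show ?thesis
    using u w unfolding P_def by auto
qed

end

lemma supp_join_subset:
  assumes "\<And>t. supp (p t) \<subseteq> F" "\<And>t. supp (q t) \<subseteq> F"
  shows "supp ((p +++ q) t) \<subseteq> F"
  using assms by (simp add: joinpaths_def)

lemma supp_segment_subsetI: "supp x \<union> supp y \<subseteq> F \<Longrightarrow> supp (segment x y t) \<subseteq> F"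
  using supp_segment_subset by blast

section \<open>Complexes with a dominating vertex\<close>

text \<open>The edges at the root form a spanning tree, so an edge uv gives the loop
  root - u - v - root.\<close>
locale rooted_complex = finite_complex +
  fixes root :: nat
  assumes root_in: "root \<in> V" and root_edge: "v \<in> V \<Longrightarrow> {root, v} \<in> K"
begin

abbreviation "pi1 \<equiv> fundamental_group S (vertex_point root)"

definition edge_loop :: "nat \<Rightarrow> nat \<Rightarrow> real \<Rightarrow> nat \<Rightarrow> real" where
  "edge_loop u v = edge root u +++ (edge u v +++ edge v root)"

definition edge_class :: "nat \<Rightarrow> nat \<Rightarrow> (real \<Rightarrow> nat \<Rightarrow> real) set" where
  "edge_class u v = path_class S (edge_loop u v)"

lemma group_pi1: "group pi1"
  by (intro group_fundamental_group vertex_point_in root_in)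

lemma path_image_root_edge: "v \<in> V \<Longrightarrow> path_image (edge root v) \<subseteq> S" "v \<in> V \<Longrightarrow> path_image (edge v root) \<subseteq> S"
  using root_edge[of v] path_image_edge by (auto simp: insert_commute)

lemma loop_in_through:
  assumes "edge_path u v p"
  shows "loop_in S (vertex_point root) (edge root u +++ (p +++ edge v root))"
  using edge_path_imp[OF assms] path_image_root_edge
  by (simp add: loop_in_def path_image_join)

lemma loop_in_edge_loop: "{u, v} \<in> K \<Longrightarrow> loop_in S (vertex_point root) (edge_loop u v)"
  unfolding edge_loop_def by (intro loop_in_through edge_path.edge)

lemma edge_class_closed: "{u, v} \<in> K \<Longrightarrow> edge_class u v \<in> carrier pi1"
  unfolding edge_class_def carrier_fundamental_group using loop_in_edge_loop by auto

lemma through_mult: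
  assumes p: "edge_path u v p" and q: "edge_path v w q" and r: "homotopic_paths S (p +++ q) r"
  shows "path_class S (edge root u +++ (p +++ edge v root)) \<otimes>\<^bsub>pi1\<^esub>
      path_class S (edge root v +++ (q +++ edge w root)) = path_class S (edge root u +++ (r +++ edge w root))"
proof -
  note pq = edge_path_imp[OF p] edge_path_imp[OF q]
  have "homotopic_paths S ((edge root u +++ (p +++ edge v root)) +++
      (reversepath (edge v root) +++ (q +++ edge w root))) (edge root u +++ (r +++ edge w root))"
    by (rule homotopic_paths_bridge[OF r]) (use pq path_image_root_edge in auto)
  from path_class_cong[OF this] show ?thesis
    by (simp add: mult_fundamental_group loop_in_through[OF p] loop_in_through[OF q])
qed

text \<open>Both paths stay in one face and are therefore contiguous. The three vertices may
  coincide; the rules for constant and reversed edges are such degenerate cases.\<close>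

lemma edge_class_mult:
  assumes "{u, v, w} \<in> K"
  shows "edge_class u v \<otimes>\<^bsub>pi1\<^esub> edge_class v w = edge_class u w"
proof -
  have K: "{u, v} \<in> K" "{v, w} \<in> K" "{u, w} \<in> K" "{u} \<in> K"
    by (rule face_down[OF assms]; auto)+
  then have V: "u \<in> V" "v \<in> V" "w \<in> V"
    using edge_vertices by auto
  have "contiguous (edge u v +++ edge v w) (edge u w)"
    unfolding contiguous_def
  proof
    fix t :: real
    have "supp ((edge u v +++ edge v w) t) \<subseteq> {u, v, w}" "supp (edge u w t) \<subseteq> {u, v, w}"
      by (intro supp_join_subset supp_segment_subsetI; simp)+
    then show "\<exists>F\<in>K. supp ((edge u v +++ edge v w) t) \<union> supp (edge u w t) \<subseteq> F"
      using assms by blast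
  qed
  then have "homotopic_paths S (edge u v +++ edge v w) (edge u w)"
    using path_image_edge[OF K(1)] path_image_edge[OF K(2)] path_image_edge[OF K(3)]
    by (intro homotopic_contiguous) (simp_all add: path_image_join)
  then show ?thesis
    unfolding edge_class_def edge_loop_def by (intro through_mult edge_path.edge K)
qed

lemma edge_class_refl: assumes "v \<in> V" shows "edge_class v v = \<one>\<^bsub>pi1\<^esub>"
proof -
  have K: "{v} \<in> K" "{v, v, v} \<in> K" "{v, v} \<in> K"
    using vertex_face[OF assms] by auto
  show ?thesis
    using group.r_cancel_one[OF group_pi1, of "edge_class v v" "edge_class v v"] edge_class_closed[of v v]
      edge_class_mult[of v v v] K by simp
qed

lemma edge_class_inv: assumes "{u, v} \<in> K" shows "edge_class v u = inv\<^bsub>pi1\<^esub> edge_class u v"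
proof -
  have "{v, u, v} \<in> K" "{v, u} \<in> K"
    using assms by (auto simp: insert_commute)
  then show ?thesis
    using edge_class_mult[of v u v] edge_class_refl[of v] edge_vertices[OF assms] edge_class_closed assms
    by (intro group.inv_equality[OF group_pi1, symmetric]) auto
qed

text \<open>The whole loop runs inside the face spanned by \<open>root\<close> and \<open>v\<close>,
  so it contracts there.\<close>

lemma edge_class_root: assumes "v \<in> V" shows "edge_class root v = \<one>\<^bsub>pi1\<^esub>"
proof -
  have K: "{root, v} \<in> K" "{root} \<in> K"
    using root_edge assms root_in vertex_face by auto
  have "contiguous (edge_loop root v) (edge root root)"
    unfolding contiguous_def
  proof
    fix t :: real
    have "supp (edge_loop root v t) \<subseteq> {root, v}" "supp (edge root root t) \<subseteq> {root, v}"
      unfolding edge_loop_def by (intro supp_join_subset supp_segment_subsetI; simp)+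
    then show "\<exists>F\<in>K. supp (edge_loop root v t) \<union> supp (edge root root t) \<subseteq> F"
      using K by blast
  qed
  moreover have "loop_in S (vertex_point root) (edge_loop root v)"
    using loop_in_edge_loop K by blast
  ultimately have "homotopic_paths S (edge_loop root v) (edge root root)"
    using path_image_edge[of root root] K
    by (intro homotopic_contiguous) (auto simp: loop_in_def simp del: segment_simps(1))
  from path_class_cong[OF this] show ?thesis
    by (simp add: edge_class_def one_fundamental_group)
qed

text \<open>Closing an edge path up through the root turns concatenation into multiplication, so
  membership in \<open>H\<close> passes from edges to all edge paths, and every loop at the root is
  one.\<close>

lemma edge_classes_generate:
  assumes H: "subgroup H pi1" and edges: "\<And>u v. {u, v} \<in> K \<Longrightarrow> edge_class u v \<in> H"
  shows "H = carrier pi1"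
proof
  show "H \<subseteq> carrier pi1"
    by (rule subgroup.subset[OF H])
  have *: "path_class S (edge root u +++ (p +++ edge v root)) \<in> H" if "edge_path u v p" for u v p
    using that
  proof (induction rule: edge_path.induct)
    case (edge u v)
    then show ?case
      using edges unfolding edge_class_def edge_loop_def by auto
  next
    case (join u v p w q)
    have "homotopic_paths S (p +++ q) (p +++ q)"
      using edge_path_imp[OF edge_path.join[OF join.hyps(1,2)]] by simp
    from through_mult[OF join.hyps(1,2) this] show ?case
      using subgroup.m_closed[OF H join.IH] by simp
  next
    case (homotopic u v p q)
    have "homotopic_paths S (edge root u +++ (p +++ edge v root)) (edge root u +++ (q +++ edge v root))"
      using edge_path_imp[OF homotopic.hyps(1)] path_image_root_edge homotopic.hyps(2)
      by (intro homotopic_paths_join) auto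
    from path_class_cong[OF this] show ?case
      using homotopic.IH by simp
  qed
  show "carrier pi1 \<subseteq> H"
  proof
    fix a assume "a \<in> carrier pi1"
    then obtain p where p: "loop_in S (vertex_point root) p" "a = path_class S p"
      by (auto simp: carrier_fundamental_group)
    have p': "path p" "path_image p \<subseteq> S" "p 0 = vertex_point root" "p 1 = vertex_point root"
      using p by (auto simp: loop_in_def pathstart_def pathfinish_def)
    let ?k = "\<lambda>_::real. vertex_point root"
    have k: "path ?k" "path_image ?k \<subseteq> S" "pathstart ?k = vertex_point root" "pathfinish ?k = vertex_point root"
      using loop_in_const[OF vertex_point_in[OF root_in]] by (auto simp: loop_in_def)
    have "edge_path root root (?k +++ (p +++ ?k))"
      using path_homotopic_edge_path[OF p'(1,2), of root root] p'(3,4) by (simp add: comp_linepath)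
    \<comment> \<open>Both the approximation and the invariant \<open>*\<close> pad a loop with
      constant segments at the root; this homotopy removes them.\<close>
    have hom: "homotopic_paths S (?k +++ (p +++ ?k)) p" if "loop_in S (vertex_point root) p" for p
    proof -
      have "homotopic_paths S (?k +++ (p +++ ?k)) (p +++ ?k)"
        using that k by (intro homotopic_paths_const_left) (simp_all add: loop_in_def path_image_join)
      also have "homotopic_paths S \<dots> p"
        using that by (intro homotopic_paths_const_right) (auto simp: loop_in_def)
      finally show ?thesis .
    qed
    have "edge_path root root p"
      by (rule edge_path.homotopic[OF \<open>edge_path root root (?k +++ (p +++ ?k))\<close> hom[OF p(1)]])
    from *[OF this] have "path_class S (?k +++ (p +++ ?k)) \<in> H"
      by simp
    then show "a \<in> H"
      using path_class_cong[OF hom[OF p(1)]] p(2) by simp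
  qed
qed

end

section \<open>Integral cocycles and winding numbers\<close>

context rooted_complex
begin

text \<open>Degenerate triples are included and force \<open>c u u = 0\<close> and
  \<open>c v u = - c u v\<close> on edges.\<close>

definition cocycle :: "(nat \<Rightarrow> nat \<Rightarrow> int) \<Rightarrow> bool" where
  "cocycle c \<longleftrightarrow> (\<forall>u v w. {u, v, w} \<in> K \<longrightarrow> c u v + c v w = c u w)"

text \<open>On the star of \<open>u\<close> the function \<open>c u\<close> is a primitive of
  \<open>c\<close>. The exponent is its affine extension, and the exponential reads it modulo the
  integers.\<close>

definition circle_chart :: "(nat \<Rightarrow> nat \<Rightarrow> int) \<Rightarrow> nat \<Rightarrow> (nat \<Rightarrow> real) \<Rightarrow> complex" where
  "circle_chart c u x = exp (2 * of_real pi * \<i> * of_real (\<Sum>v\<in>V. x v * of_int (c u v)))"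

text \<open>The charts at two vertices of a face differ by an integral multiple of 2 pi i in the
  exponent, because barycentric coordinates sum to 1.\<close>
definition circle_map :: "(nat \<Rightarrow> nat \<Rightarrow> int) \<Rightarrow> (nat \<Rightarrow> real) \<Rightarrow> complex" where
  "circle_map c x = circle_chart c (SOME u. u \<in> supp x) x"

lemma circle_chart_eq:
  assumes c: "cocycle c" and x: "x \<in> S" and F: "F \<in> K" "supp x \<subseteq> F" "u \<in> F" "w \<in> F"
  shows "circle_chart c u x = circle_chart c w x"
proof -
  have "x v * of_int (c u v) = x v * of_int (c u w) + x v * of_int (c w v)" if "v \<in> V" for v
  proof (cases "v \<in> supp x")
    case True
    then have "{u, w, v} \<in> K"
      using F by (intro face_down[OF F(1)]) auto
    then have "c u w + c w v = c u v"
      using c unfolding cocycle_def by blast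
    then show ?thesis
      by (simp flip: distrib_left of_int_add)
  qed (auto simp: supp_def)
  then have "(\<Sum>v\<in>V. x v * of_int (c u v)) = (\<Sum>v\<in>V. x v * of_int (c u w)) + (\<Sum>v\<in>V. x v * of_int (c w v))"
    by (simp flip: sum.distrib)
  moreover have "(\<Sum>v\<in>V. x v * of_int (c u w)) = of_int (c u w)"
    using x by (simp add: mem_realization_iff flip: sum_distrib_right)
  ultimately have "2 * of_real pi * \<i> * of_real (\<Sum>v\<in>V. x v * of_int (c u v)) =
      2 * of_real pi * \<i> * of_real (\<Sum>v\<in>V. x v * of_int (c w v)) + \<i> * (of_int (c u w) * (of_real pi * 2))"
    by (simp add: algebra_simps)
  then show ?thesis
    unfolding circle_chart_def by (simp only: exp_add exp_2pi_1_int mult_1_right)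
qed

lemma circle_map_eq:
  assumes "cocycle c" "x \<in> S" "F \<in> K" "supp x \<subseteq> F" "u \<in> F"
  shows "circle_map c x = circle_chart c u x"
proof -
  have "(SOME u. u \<in> supp x) \<in> supp x"
    using face_nonempty[OF support_face[OF assms(2)]] by (simp add: some_in_eq)
  then show ?thesis
    unfolding circle_map_def using assms by (intro circle_chart_eq) auto
qed

text \<open>Near \<open>x\<close> the coordinate \<open>u\<close> stays nonzero, and on this open
  star the map agrees with the single chart at \<open>u\<close>, which is continuous
  everywhere.\<close>

lemma continuous_circle_map:
  assumes c: "cocycle c"
  shows "continuous_on S (circle_map c)"
  unfolding continuous_on_def
proof
  fix x assume x: "x \<in> S"
  then obtain u where u: "u \<in> supp x"
    using face_nonempty[OF support_face] by blast
  have "continuous_on UNIV (circle_chart c u)"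
    unfolding circle_chart_def by (intro continuous_intros continuous_on_product_coordinates)
  then have "(circle_chart c u \<longlongrightarrow> circle_chart c u x) (at x within S)"
    by (meson UNIV_I continuous_on_def subset_UNIV tendsto_within_subset)
  moreover have "\<forall>\<^sub>F y in at x within S. circle_chart c u y = circle_map c y"
    unfolding eventually_at_topological
  proof (intro exI[of _ "{y. y u \<noteq> 0}"] conjI ballI impI)
    have "open ((\<lambda>y::nat \<Rightarrow> real. y u) -` (- {0}))"
      by (intro open_vimage continuous_on_product_coordinates) auto
    then show "open {y::nat \<Rightarrow> real. y u \<noteq> 0}"
      by (simp add: vimage_def)
    show "circle_chart c u y = circle_map c y" if "y \<in> {y. y u \<noteq> 0}" "y \<in> S" for y
      using circle_map_eq[OF c that(2) support_face[OF that(2)]] that(1) by (simp add: supp_def)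
  qed (use u in \<open>auto simp: supp_def\<close>)
  moreover have "circle_map c x = circle_chart c u x"
    by (rule circle_map_eq[OF c x support_face[OF x] order_refl u])
  ultimately show "(circle_map c \<longlongrightarrow> circle_map c x) (at x within S)"
    using Lim_transform_eventually by fastforce
qed

lemma circle_map_nonzero: "circle_map c x \<noteq> 0"
  by (simp add: circle_map_def circle_chart_def)

section \<open>Winding numbers of paths under the circle map\<close>

definition turns :: "(nat \<Rightarrow> nat \<Rightarrow> int) \<Rightarrow> (real \<Rightarrow> nat \<Rightarrow> real) \<Rightarrow> complex" where
  "turns c p = winding_number (circle_map c \<circ> p) 0"

lemma path_circle_map:
  assumes "cocycle c" "path p" "path_image p \<subseteq> S"
  shows "path (circle_map c \<circ> p)" "0 \<notin> path_image (circle_map c \<circ> p)"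
  using assms continuous_on_subset[OF continuous_circle_map] circle_map_nonzero
  by (auto intro!: path_continuous_image simp: path_image_def)

lemma turns_join:
  assumes "cocycle c" "path p" "path_image p \<subseteq> S" "path q" "path_image q \<subseteq> S" "pathfinish p = pathstart q"
  shows "turns c (p +++ q) = turns c p + turns c q"
  using path_circle_map[OF assms(1-3)] path_circle_map[OF assms(1,4,5)] assms(6)
  by (simp add: turns_def path_compose_join winding_number_join pathfinish_compose pathstart_compose)

lemma turns_homotopic:
  assumes "cocycle c" "homotopic_paths S p q"
  shows "turns c p = turns c q"
  unfolding turns_def
proof (rule winding_number_homotopic_paths)
  show "homotopic_paths (- {0}) (circle_map c \<circ> p) (circle_map c \<circ> q)"
    using circle_map_nonzero
    by (intro homotopic_paths_continuous_image[OF assms(2) continuous_circle_map[OF assms(1)]]) auto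
qed

text \<open>Along an edge the circle map is the exponential of a straight path from 0 to 2 pi i
  \<open>c u v\<close>, and the winding number of such a path is read off from its ends.\<close>

lemma turns_edge:
  assumes c: "cocycle c" and uv: "{u, v} \<in> K"
  shows "turns c (edge u v) = of_int (c u v)"
proof -
  have V: "u \<in> V" "v \<in> V"
    using edge_vertices[OF uv] by auto
  have "{u, u, u} \<in> K"
    using V vertex_face by simp
  then have cuu: "c u u = 0"
    using c[unfolded cocycle_def, rule_format, of u u u] by simp
  let ?l = "linepath 0 (2 * of_real pi * \<i> * of_int (c u v))"
  have "(circle_map c \<circ> edge u v) t = (exp \<circ> ?l) t" if t: "0 \<le> t" "t \<le> 1" for t
  proof -
    have "edge u v t \<in> S"
      using V t by (intro segment_in[OF _ _ uv] vertex_point_in) auto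
    then have "circle_map c (edge u v t) = circle_chart c u (edge u v t)"
      using uv by (intro circle_map_eq[OF c _ uv] supp_segment_subsetI) auto
    moreover have "(\<Sum>w\<in>V. edge u v t w * of_int (c u w)) = t * of_int (c u v)"
    proof -
      have "(\<Sum>w\<in>V. edge u v t w * of_int (c u w)) =
        (1 - t) * (\<Sum>w\<in>V. if w = u then of_int (c u w) else 0) + t * (\<Sum>w\<in>V. if w = v then of_int (c u w) else 0)"
        unfolding sum_distrib_left sum.distrib[symmetric]
        by (intro sum.cong) (auto simp: segment_def vertex_point_def algebra_simps)
      also have "\<dots> = t * of_int (c u v)"
        using V finite_V cuu by (simp add: sum.delta)
      finally show ?thesis .
    qed
    ultimately have "circle_map c (edge u v t) = exp (2 * of_real pi * \<i> * of_real (t * of_int (c u v)))"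
      by (simp only: circle_chart_def)
    then show ?thesis
      by (simp add: linepath_def scaleR_conv_of_real mult_ac)
  qed
  then have "turns c (edge u v) = winding_number (exp \<circ> ?l) 0"
    unfolding turns_def by (intro winding_number_cong) auto
  then show ?thesis
    by (simp add: winding_number_compose_exp)
qed

text \<open>Winding numbers are homotopy invariant and additive. Since \<open>c\<close> vanishes on
  the tree, the two root edges of \<open>edge_loop\<close> contribute nothing and exactly
  \<open>c u v\<close> remains.\<close>

lemma cocycle_hom:
  assumes c: "cocycle c" and c_root: "\<And>v. v \<in> V \<Longrightarrow> c root v = 0"
  shows "\<exists>h\<in>hom pi1 integer_group. \<forall>u v. {u, v} \<in> K \<longrightarrow> h (edge_class u v) = c u v"
proof -
  \<comment> \<open>Winding numbers are complex-valued but integral on loops, so the floor of the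
    real part loses nothing.\<close>
  define h where "h a = \<lfloor>Re (turns c (SOME p. p \<in> a))\<rfloor>" for a
  have h: "of_int (h (path_class S p)) = turns c p" if p: "loop_in S (vertex_point root) p" for p
  proof -
    have "homotopic_paths S p (SOME q. q \<in> path_class S p)"
      using someI[of "\<lambda>q. homotopic_paths S p q" p] p by (simp add: path_class_def loop_in_def)
    then have "h (path_class S p) = \<lfloor>Re (turns c p)\<rfloor>"
      using turns_homotopic[OF c] by (simp add: h_def)
    moreover have "turns c p \<in> \<int>"
      unfolding turns_def using p path_circle_map[OF c]
      by (intro integer_winding_number) (auto simp: loop_in_def pathstart_compose pathfinish_compose)
    ultimately show ?thesis
      by (auto elim!: Ints_cases)
  qed
  have "h \<in> hom pi1 integer_group"
  proof (rule homI)
    fix a b assume "a \<in> carrier pi1" "b \<in> carrier pi1"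
    then obtain p q where pq: "loop_in S (vertex_point root) p" "loop_in S (vertex_point root) q"
      "a = path_class S p" "b = path_class S q"
      by (auto simp: carrier_fundamental_group)
    have "(of_int (h (path_class S (p +++ q))) :: complex) = of_int (h a + h b)"
      using pq h[OF loop_in_join[OF pq(1,2)]] h[OF pq(1)] h[OF pq(2)] turns_join[OF c, of p q]
      by (simp add: loop_in_def)
    then have "h (path_class S (p +++ q)) = h a + h b"
      by (simp only: of_int_eq_iff)
    then show "h (a \<otimes>\<^bsub>pi1\<^esub> b) = h a \<otimes>\<^bsub>integer_group\<^esub> h b"
      using pq by (simp add: mult_fundamental_group)
  qed auto
  moreover have "h (edge_class u v) = c u v" if uv: "{u, v} \<in> K" for u v
  proof -
    have V: "u \<in> V" "v \<in> V"
      using edge_vertices[OF uv] by auto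
    have "{root, v, root} \<in> K" "{root, root, root} \<in> K"
      using root_edge[OF V(2)] vertex_face[OF root_in] by (auto simp: insert_commute)
    then have "c v root = 0"
      using c[unfolded cocycle_def, rule_format, of root v root] c_root V(2) root_in by simp
    have K: "{root, u} \<in> K" "{v, root} \<in> K"
      using root_edge[OF V(1)] root_edge[OF V(2)] by (auto simp: insert_commute)
    have "(of_int (h (edge_class u v)) :: complex) = turns c (edge_loop u v)"
      unfolding edge_class_def using h loop_in_edge_loop[OF uv] by blast
    also have "\<dots> = of_int (c root u) + (of_int (c u v) + of_int (c v root))"
      unfolding edge_loop_def
      using path_image_edge[OF uv] path_image_edge[OF K(1)] path_image_edge[OF K(2)]
      by (simp add: turns_join c turns_edge uv K path_image_join)
    finally show ?thesis
      using c_root[OF V(1)] \<open>c v root = 0\<close> by simp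
  qed
  ultimately show ?thesis
    by blast
qed

end

section \<open>Recognizing free abelian groups\<close>

lemma (in group) subgroup_centralizer:
  assumes x: "x \<in> carrier G"
  shows "subgroup {y \<in> carrier G. x \<otimes> y = y \<otimes> x} G"
proof (rule subgroupI)
  fix a b assume "a \<in> {y \<in> carrier G. x \<otimes> y = y \<otimes> x}" "b \<in> {y \<in> carrier G. x \<otimes> y = y \<otimes> x}"
  then have ab: "a \<in> carrier G" "b \<in> carrier G" "x \<otimes> a = a \<otimes> x" "x \<otimes> b = b \<otimes> x"
    by auto
  have "x \<otimes> (a \<otimes> b) = a \<otimes> x \<otimes> b"
    using x ab by (simp flip: m_assoc)
  also have "\<dots> = a \<otimes> b \<otimes> x"
    using x ab by (simp add: m_assoc)
  finally show "a \<otimes> b \<in> {y \<in> carrier G. x \<otimes> y = y \<otimes> x}"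
    using ab by simp
next
  fix a assume a: "a \<in> {y \<in> carrier G. x \<otimes> y = y \<otimes> x}"
  then have "x = a \<otimes> x \<otimes> inv a"
    using x inv_solve_right[of x "a \<otimes> x" a] by auto
  then have "inv a \<otimes> x = x \<otimes> inv a"
    using a x inv_solve_left[of "x \<otimes> inv a" a x] m_assoc by auto
  then show "inv a \<in> {y \<in> carrier G. x \<otimes> y = y \<otimes> x}"
    using a by auto
qed (use x in auto)

lemma hom_integer_pow:
  assumes "group G" "h \<in> hom G integer_group" "x \<in> carrier G"
  shows "h (x [^]\<^bsub>G\<^esub> (n::int)) = n * h x"
proof -
  interpret group_hom G integer_group h
    using assms by (simp add: group_hom_def group_hom_axioms_def)
  show ?thesis
    using hom_int_pow[OF assms(3), of n] by (simp add: mult.commute)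
qed

lemma hom_integer_finprod:
  assumes "comm_group G" "h \<in> hom G integer_group" "finite A" "f \<in> A \<rightarrow> carrier G"
  shows "h (finprod G f A) = (\<Sum>i\<in>A. h (f i))"
proof -
  interpret comm_group G by fact
  interpret group_hom G integer_group h
    using assms by (simp add: group_hom_def group_hom_axioms_def is_group)
  show ?thesis
    using assms(3,4)
  proof (induction A rule: finite_induct)
    case empty
    then show ?case using hom_one by simp
  next
    case (insert a A)
    then show ?case by (simp add: Pi_def)
  qed
qed

text \<open>Applying \<open>gen\<close> to centralizers spreads commutation from pairs of generators
  to the whole group. The map from \<open>Zpow m\<close> is then onto because its image is a
  subgroup containing the generators, and injective because \<open>h k\<close> reads off the k-th
  exponent.\<close>

lemma iso_Zpow:
  fixes G (structure)
  assumes "group G" and g: "\<And>i. i < m \<Longrightarrow> g i \<in> carrier G"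
    and comm: "\<And>i j. i < m \<Longrightarrow> j < m \<Longrightarrow> g i \<otimes> g j = g j \<otimes> g i"
    and gen: "\<And>H. subgroup H G \<Longrightarrow> (\<And>i. i < m \<Longrightarrow> g i \<in> H) \<Longrightarrow> H = carrier G"
    and h: "\<And>k. k < m \<Longrightarrow> h k \<in> hom G integer_group"
    and hg: "\<And>i k. i < m \<Longrightarrow> k < m \<Longrightarrow> h k (g i) = (if i = k then 1 else 0)"
  shows "G \<cong> Zpow m"
proof -
  interpret group G by fact
  have 1: "g i \<otimes> y = y \<otimes> g i" if "i < m" "y \<in> carrier G" for i y
    using gen[OF subgroup_centralizer[OF g[OF that(1)]]] that g comm by blast
  have "x \<otimes> y = y \<otimes> x" if "x \<in> carrier G" "y \<in> carrier G" for x y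
    using gen[OF subgroup_centralizer[OF that(1)]] that g 1 by fastforce
  then interpret comm_group G
    by (intro group_comm_groupI)
  have gZ: "group (Zpow m)"
    by (simp add: Zpow_def)
  define \<psi> where "\<psi> z = (\<Otimes>k\<in>{..<m}. g k [^] (z k :: int))" for z
  have \<psi>: "\<psi> \<in> hom (Zpow m) G"
  proof (rule homI)
    fix y z assume "y \<in> carrier (Zpow m)" "z \<in> carrier (Zpow m)"
    have "\<psi> (y \<otimes>\<^bsub>Zpow m\<^esub> z) = (\<Otimes>k\<in>{..<m}. g k [^] y k \<otimes> g k [^] z k)"
      unfolding \<psi>_def using g by (intro finprod_cong) (auto simp: Zpow_def int_pow_mult simp_implies_def)
    also have "\<dots> = \<psi> y \<otimes> \<psi> z"
      unfolding \<psi>_def using g by (intro finprod_multf) auto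
    finally show "\<psi> (y \<otimes>\<^bsub>Zpow m\<^esub> z) = \<psi> y \<otimes> \<psi> z" .
  qed (use g in \<open>auto simp: \<psi>_def\<close>)
  then interpret \<psi>: group_hom "Zpow m" G \<psi>
    by (simp add: group_hom_def group_hom_axioms_def gZ is_group)
  have h\<psi>: "h k (\<psi> z) = z k" if "k < m" for k z
  proof -
    have "h k (\<psi> z) = (\<Sum>i<m. h k (g i [^] z i))"
      unfolding \<psi>_def using g that by (intro hom_integer_finprod h) (auto simp: comm_group_axioms)
    also have "\<dots> = (\<Sum>i<m. if i = k then z i else 0)"
      using g h that by (intro sum.cong) (auto simp: hom_integer_pow[OF is_group] hg)
    finally show ?thesis
      using that by simp
  qed
  have "inj_on \<psi> (carrier (Zpow m))"
  proof (rule inj_onI)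
    fix y z assume yz: "y \<in> carrier (Zpow m)" "z \<in> carrier (Zpow m)" and "\<psi> y = \<psi> z"
    then have "y k = z k" if "k < m" for k
      using h\<psi>[OF that, of y] h\<psi>[OF that, of z] by simp
    then show "y = z"
      using yz by (intro PiE_ext[of y "{..<m}"]) (auto simp: Zpow_def)
  qed
  moreover have "\<psi> ` carrier (Zpow m) = carrier G"
  proof (rule gen[OF \<psi>.img_is_subgroup])
    fix i assume i: "i < m"
    \<comment> \<open>The k-indexed unit vector, restricted because elements of
      \<open>Zpow m\<close> are undefined outside \<open>{..<m}\<close>.\<close>
    let ?z = "\<lambda>k\<in>{..<m}. if k = i then 1 else 0 :: int"
    have "\<psi> ?z = (\<Otimes>k\<in>{..<m}. if i = k then g k else \<one>)"
      unfolding \<psi>_def using g by (intro finprod_cong) (auto simp: simp_implies_def)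
    also have "\<dots> = g i"
      using i g by (intro finprod_singleton) auto
    finally have "g i = \<psi> ?z" by simp
    moreover have "?z \<in> carrier (Zpow m)"
      by (auto simp: Zpow_def)
    ultimately show "g i \<in> \<psi> ` carrier (Zpow m)"
      by blast
  qed
  ultimately have "\<psi> \<in> iso (Zpow m) G"
    using \<psi> by (simp add: iso_def bij_betw_def)
  then have "Zpow m \<cong> G"
    by (auto simp: is_iso_def)
  then show ?thesis
    using group.iso_sym[OF gZ] by blast
qed

section \<open>The seven-vertex torus\<close>

text \<open>The vertices are the residues mod 7, the triangles are {x, x+1, x+3} and {x, x+2, x+3}.\<close>
definition torus :: "'a \<Rightarrow> 'a \<Rightarrow> 'a \<Rightarrow> 'a \<Rightarrow> 'a \<Rightarrow> 'a \<Rightarrow> 'a \<Rightarrow> ('a \<times> 'a \<times> 'a) set" where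
  "torus v0 v1 v2 v3 v4 v5 v6 =
    {(v0, v1, v3), (v1, v2, v4), (v2, v3, v5), (v3, v4, v6), (v4, v5, v0), (v5, v6, v1), (v6, v0, v2),
     (v0, v2, v3), (v1, v3, v4), (v2, v4, v5), (v3, v5, v6), (v4, v6, v0), (v5, v0, v1), (v6, v1, v2)}"

context rooted_complex
begin

lemma edge_class_triangle:
  assumes "{x, y, z} \<in> K" "u \<in> {x, y, z}" "v \<in> {x, y, z}" "w \<in> {x, y, z}"
  shows "edge_class u v \<otimes>\<^bsub>pi1\<^esub> edge_class v w = edge_class u w"
  by (rule edge_class_mult, rule face_down[OF assms(1)]) (use assms(2-) in auto)

lemma triangle_in_subgroup:
  assumes H: "subgroup H pi1" and K: "{x, y, z} \<in> K"
    and in_H: "edge_class x y \<in> H" "edge_class y z \<in> H"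
    and uv: "u \<in> {x, y, z}" "v \<in> {x, y, z}"
  shows "edge_class u v \<in> H"
proof -
  have V: "x \<in> V" "y \<in> V" "z \<in> V"
    using face_subset[OF K] by auto
  have "edge_class x z \<in> H"
    using subgroup.m_closed[OF H in_H] edge_class_triangle[OF K, of x y z] by simp
  moreover have "edge_class b a \<in> H" if "edge_class a b \<in> H" "{a, b} \<subseteq> {x, y, z}" for a b
  proof -
    have "{a, b} \<in> K"
      by (rule face_down[OF K]) (use that in auto)
    then show ?thesis
      using subgroup.m_inv_closed[OF H that(1)] edge_class_inv by simp
  qed
  ultimately have "edge_class y x \<in> H" "edge_class z y \<in> H" "edge_class z x \<in> H" "edge_class x z \<in> H"
    using in_H by auto
  then show ?thesis
    using uv in_H subgroup.one_closed[OF H] edge_class_refl V by auto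
qed

text \<open>Two sides of the triangle through the root, \<open>u\<close> and \<open>v\<close> lie in
  the spanning tree, so the third side is trivial too.\<close>

lemma edge_class_link:
  assumes "{x, y, z} \<in> K" "root \<in> {x, y, z}" "u \<in> {x, y, z}" "v \<in> {x, y, z}"
  shows "edge_class u v = \<one>\<^bsub>pi1\<^esub>"
proof -
  interpret group pi1
    by (rule group_pi1)
  have "u \<in> V" "v \<in> V"
    using assms face_subset by blast+
  moreover have "{u, v} \<in> K"
    by (rule face_down[OF assms(1)]) (use assms in auto)
  ultimately show ?thesis
    using edge_class_triangle[OF assms] edge_class_root edge_class_closed by simp
qed

text \<open>After the edges at the root and in its link are killed, the remaining nine edges carry
  only A, B and D up to inversion, where A and B are the classes of the two generators. Two
  triangles read DB = A and BD = A, so A commutes with B and D = A B^-1.\<close>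

lemma torus_classes:
  fixes v1 v2 v3 v4 v5 v6 :: nat
  assumes T: "\<And>x y z. (x, y, z) \<in> torus root v1 v2 v3 v4 v5 v6 \<Longrightarrow> {x, y, z} \<in> K"
  shows torus_commute: "edge_class v3 v6 \<otimes>\<^bsub>pi1\<^esub> edge_class v2 v4 = edge_class v2 v4 \<otimes>\<^bsub>pi1\<^esub> edge_class v3 v6"
    and torus_subgroup: "\<lbrakk>subgroup H pi1; edge_class v3 v6 \<in> H; edge_class v2 v4 \<in> H;
      (x, y, z) \<in> torus root v1 v2 v3 v4 v5 v6; u \<in> {x, y, z}; v \<in> {x, y, z}\<rbrakk> \<Longrightarrow> edge_class u v \<in> H"
proof -
  interpret group pi1
    by (rule group_pi1)
  have K: "{root, v1, v3} \<in> K" "{v1, v2, v4} \<in> K" "{v2, v3, v5} \<in> K" "{v3, v4, v6} \<in> K"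
    "{v4, v5, root} \<in> K" "{v5, v6, v1} \<in> K" "{v6, root, v2} \<in> K" "{root, v2, v3} \<in> K"
    "{v1, v3, v4} \<in> K" "{v2, v4, v5} \<in> K" "{v3, v5, v6} \<in> K" "{v4, v6, root} \<in> K"
    "{v5, root, v1} \<in> K" "{v6, v1, v2} \<in> K"
    by (rule T; simp add: torus_def)+
  note mult = K[THEN edge_class_triangle]
  have closed: "edge_class a b \<in> carrier pi1" if "{a, b} \<subseteq> {x, y, z}" "{x, y, z} \<in> K" for a b x y z
    using that by (intro edge_class_closed face_down[OF that(2)]) auto
  \<comment> \<open>These six edges form the link of the root, the hexagon \<open>v1\<close>,
    \<open>v3\<close>, \<open>v2\<close>, \<open>v6\<close>, \<open>v4\<close>,
    \<open>v5\<close>.\<close>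
  have one: "edge_class v1 v3 = \<one>\<^bsub>pi1\<^esub>" "edge_class v2 v3 = \<one>\<^bsub>pi1\<^esub>" "edge_class v6 v2 = \<one>\<^bsub>pi1\<^esub>"
    "edge_class v4 v6 = \<one>\<^bsub>pi1\<^esub>" "edge_class v4 v5 = \<one>\<^bsub>pi1\<^esub>" "edge_class v5 v1 = \<one>\<^bsub>pi1\<^esub>"
    using edge_class_link[OF K(1), of v1 v3] edge_class_link[OF K(8), of v2 v3]
      edge_class_link[OF K(7), of v6 v2] edge_class_link[OF K(12), of v4 v6]
      edge_class_link[OF K(5), of v4 v5] edge_class_link[OF K(13), of v5 v1] by simp_all
  have cl: "edge_class v3 v4 \<in> carrier pi1" "edge_class v3 v6 \<in> carrier pi1" "edge_class v2 v4 \<in> carrier pi1"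
    "edge_class v3 v5 \<in> carrier pi1" "edge_class v1 v2 \<in> carrier pi1" "edge_class v6 v1 \<in> carrier pi1"
    "edge_class v5 v6 \<in> carrier pi1"
    using closed[OF _ K(4)] closed[OF _ K(2)] closed[OF _ K(11)] closed[OF _ K(14)] by simp_all
  have eq: "edge_class v3 v4 = edge_class v3 v6" "edge_class v2 v5 = edge_class v2 v4"
    using mult(4)[of v3 v4 v6] mult(10)[of v2 v4 v5] cl by (simp_all add: one)
  have eq': "edge_class v1 v4 = edge_class v3 v6" "edge_class v3 v5 = edge_class v2 v4"
    using mult(9)[of v1 v3 v4] mult(3)[of v2 v3 v5] cl by (simp_all add: one eq)
  have D61: "edge_class v6 v1 = inv\<^bsub>pi1\<^esub> edge_class v1 v2"
    using mult(14)[of v6 v1 v2] cl by (simp add: one inv_equality)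
  have D56: "edge_class v5 v6 = edge_class v1 v2"
    using mult(6)[of v5 v6 v1] cl inv_equality[of "edge_class v5 v6" "edge_class v6 v1"] by (simp add: one D61)
  note eq = eq eq' D61 D56
  let ?A = "edge_class v3 v6" and ?B = "edge_class v2 v4" and ?D = "edge_class v1 v2"
  have AB: "?D \<otimes>\<^bsub>pi1\<^esub> ?B = ?A" "?B \<otimes>\<^bsub>pi1\<^esub> ?D = ?A"
    using mult(2)[of v1 v2 v4] mult(11)[of v3 v5 v6] by (simp_all add: eq)
  have ABD: "?A \<in> carrier pi1" "?B \<in> carrier pi1" "?D \<in> carrier pi1"
    using cl by auto
  \<comment> \<open>With A = BD = DB both sides equal BDB.\<close>
  show "?A \<otimes>\<^bsub>pi1\<^esub> ?B = ?B \<otimes>\<^bsub>pi1\<^esub> ?A"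
    using AB ABD m_assoc[of ?B ?D ?B] by simp
  assume H: "subgroup H pi1" and A: "?A \<in> H" and B: "?B \<in> H"
    and xyz: "(x, y, z) \<in> torus root v1 v2 v3 v4 v5 v6" and uv: "u \<in> {x, y, z}" "v \<in> {x, y, z}"
  have "?D = ?A \<otimes>\<^bsub>pi1\<^esub> inv\<^bsub>pi1\<^esub> ?B"
    using AB(1) ABD by (metis inv_solve_right)
  then have D: "?D \<in> H"
    using H A B by (simp add: subgroup.m_closed subgroup.m_inv_closed)
  have link: "edge_class u v \<in> H" if "{x, y, z} \<in> K" "root \<in> {x, y, z}" "u \<in> {x, y, z}" "v \<in> {x, y, z}" for x y z u v
    using edge_class_link[OF that] subgroup.one_closed[OF H] by simp
  have D': "inv\<^bsub>pi1\<^esub> ?D \<in> H" and 1: "\<one>\<^bsub>pi1\<^esub> \<in> H"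
    using D H by (simp_all add: subgroup.m_inv_closed subgroup.one_closed)
  have "edge_class x y \<in> H \<and> edge_class y z \<in> H"
    using xyz unfolding torus_def insert_iff empty_iff
    by (elim disjE; clarsimp simp: one eq A B D D' 1 link[OF K(1)] link[OF K(5)] link[OF K(7)] link[OF K(8)] link[OF K(12)] link[OF K(13)])
  then show "edge_class u v \<in> H"
    using triangle_in_subgroup[OF H T[OF xyz] _ _ uv] by blast
qed

end

section \<open>Tori glued along an edge colouring\<close>

text \<open>\<open>CycA i\<close> and \<open>CycB i\<close> complete the triangle of generator i;
  \<open>ColA c\<close> and \<open>ColB c\<close> are the two vertices common to all pairs of colour
  c.\<close>

datatype vtx = Base | CycA nat | CycB nat | ColA nat | ColB nat

instance vtx :: countable
  by countable_datatype

locale edge_colouring =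
  fixes m C :: nat and col :: "nat \<Rightarrow> nat \<Rightarrow> nat"
  assumes col_less: "i < m \<Longrightarrow> j < m \<Longrightarrow> i \<noteq> j \<Longrightarrow> col i j < C"
    and col_sym: "col i j = col j i"
    and col_proper: "i < m \<Longrightarrow> j < m \<Longrightarrow> k < m \<Longrightarrow> i \<noteq> j \<Longrightarrow> i \<noteq> k \<Longrightarrow> col i j = col i k \<Longrightarrow> j = k"
begin

definition verts :: "vtx set" where
  "verts = insert Base (CycA ` {..<m} \<union> CycB ` {..<m} \<union> ColA ` {..<C} \<union> ColB ` {..<C})"

text \<open>Generator \<open>i\<close> takes positions 3 and 6, and \<open>j\<close> takes 2 and 4:
  together with position 0 neither pair spans a face, so neither triangle is filled in. Positions 5
  and 1 are left to the colour, and {5, 0, 1} is a face. The placement is not symmetric, so it is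
  used for \<open>i < j\<close> only.\<close>

abbreviation pair_torus :: "nat \<Rightarrow> nat \<Rightarrow> (vtx \<times> vtx \<times> vtx) set" where
  "pair_torus i j \<equiv> torus Base (ColB (col i j)) (CycA j) (CycA i) (CycB j) (ColA (col i j)) (CycB i)"

text \<open>The degenerate triples are edges. They join every vertex to the base, including colour
  vertices that lie in no torus, and they provide the generator edge when there is just one
  generator and no torus.\<close>

definition triangles :: "(vtx \<times> vtx \<times> vtx) set" where
  "triangles = (\<Union>i<m. \<Union>j\<in>{i<..<m}. pair_torus i j) \<union> (\<lambda>v. (Base, v, v)) ` verts
     \<union> (\<lambda>i. (CycA i, CycB i, CycB i)) ` {..<m}"

definition faces :: "vtx set set" where
  "faces = {F. F \<noteq> {} \<and> (\<exists>(x, y, z)\<in>triangles. F \<subseteq> {x, y, z})}"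

lemma trianglesE:
  assumes "(x, y, z) \<in> triangles"
  obtains i j where "i < j" "j < m" "(x, y, z) \<in> pair_torus i j"
    | v where "v \<in> verts" "x = Base" "y = v" "z = v"
    | i where "i < m" "x = CycA i" "y = CycB i" "z = CycB i"
  using assms unfolding triangles_def by auto

lemma triangle_verts: "(x, y, z) \<in> triangles \<Longrightarrow> {x, y, z} \<subseteq> verts"
proof (erule trianglesE)
  fix i j assume ij: "i < j" "j < m" and "(x, y, z) \<in> pair_torus i j"
  then show "{x, y, z} \<subseteq> verts"
    using col_less[of i j] by (auto simp: torus_def verts_def)
qed (auto simp: verts_def)

lemma finite_verts: "finite verts"
  by (simp add: verts_def)

lemma card_verts: "card verts = 1 + 2 * m + 2 * C"
proof -
  have "card (CycA ` {..<m} \<union> CycB ` {..<m} \<union> ColA ` {..<C} \<union> ColB ` {..<C}) = m + m + C + C"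
    by (subst card_Un_disjoint; auto simp: card_image inj_on_def)+
  moreover have "Base \<notin> CycA ` {..<m} \<union> CycB ` {..<m} \<union> ColA ` {..<C} \<union> ColB ` {..<C}"
    by auto
  ultimately show ?thesis
    unfolding verts_def by simp
qed

definition V :: "nat set" where "V = to_nat ` verts"

definition K :: "nat set set" where "K = (`) to_nat ` faces"

lemma simplicial_complex_VK: "simplicial_complex V K"
  unfolding simplicial_complex_def
proof (intro conjI ballI allI impI)
  show "finite V"
    by (simp add: V_def finite_verts)
  show "F \<noteq> {}" "F \<subseteq> V" if "F \<in> K" for F
    using that triangle_verts unfolding K_def V_def faces_def by (fastforce, fastforce)
  show "G \<in> K" if "F \<in> K" and G: "G \<noteq> {} \<and> G \<subseteq> F" for F G
  proof -
    obtain F' where F': "F' \<in> faces" "F = to_nat ` F'"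
      using \<open>F \<in> K\<close> by (auto simp: K_def)
    obtain G' where G': "G' \<subseteq> F'" "G = to_nat ` G'"
      using G F' by (auto simp: subset_image_iff)
    then have "G' \<in> faces"
      using F' G unfolding faces_def by blast
    then show ?thesis
      using G' by (simp add: K_def)
  qed
  show "{v} \<in> K" if v: "v \<in> V" for v
  proof -
    obtain x where x: "x \<in> verts" "v = to_nat x"
      using v by (auto simp: V_def)
    then have "(Base, x, x) \<in> triangles"
      by (simp add: triangles_def)
    then have "{x} \<in> faces"
      unfolding faces_def by auto
    then show ?thesis
      using x by (auto simp: K_def intro: image_eqI[of _ _ "{x}"])
  qed
qed

lemma to_nat_image_in_K: "to_nat ` F \<in> K \<longleftrightarrow> F \<in> faces"
  unfolding K_def by (auto simp: inj_image_eq_iff)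

lemma triangle_face: "(x, y, z) \<in> triangles \<Longrightarrow> {to_nat x, to_nat y, to_nat z} \<in> K"
  using to_nat_image_in_K[of "{x, y, z}"] by (auto simp: faces_def)

sublocale rooted_complex V K "to_nat Base"
proof unfold_locales
  show "simplicial_complex V K"
    by (rule simplicial_complex_VK)
  show "to_nat Base \<in> V"
    by (simp add: V_def verts_def)
  show "{to_nat Base, v} \<in> K" if v: "v \<in> V" for v
  proof -
    obtain x where "x \<in> verts" "v = to_nat x"
      using v by (auto simp: V_def)
    then show ?thesis
      using triangle_face[of Base x x] by (auto simp: triangles_def)
  qed
qed

section \<open>The dual cocycles\<close>

definition partner :: "nat \<Rightarrow> nat \<Rightarrow> nat" where
  "partner c i = (THE j. j < m \<and> j \<noteq> i \<and> col i j = c)"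

text \<open>Properness makes the pair recoverable from a colour and one of its generators. An edge
  between a colour vertex and a generator vertex thus lies in one torus only, and its value can be
  prescribed from its two ends.\<close>

lemma partner_col:
  assumes "i < m" "j < m" "i \<noteq> j"
  shows "partner (col i j) i = j" "partner (col i j) j = i"
proof -
  have "partner (col i j) i = j" if "i < m" "j < m" "i \<noteq> j" for i j
    unfolding partner_def using that by (intro the_equality) (auto intro: col_proper[of i])
  from this[OF assms] this[of j i] show "partner (col i j) i = j" "partner (col i j) j = i"
    using assms col_sym[of i j] by auto
qed

definition \<delta> :: "nat \<Rightarrow> nat \<Rightarrow> int" where "\<delta> k i = of_bool (k = i)"

text \<open>In the torus of i < j the edges off the star of the base vertex have the classes
  0, a_i, a_j and a_i - a_j; their k-th coordinates are recorded here in one orientation.\<close>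
fun half_dual :: "nat \<Rightarrow> vtx \<Rightarrow> vtx \<Rightarrow> int" where
  "half_dual k (CycA i) (CycB j) = (if i \<le> j then \<delta> k i else 0)"
| "half_dual k (CycA i) (ColA c) = \<delta> k (max i (partner c i))"
| "half_dual k (ColA c) (CycB i) = (if i < partner c i then \<delta> k i - \<delta> k (partner c i) else 0)"
| "half_dual k (ColB c) (CycA i) = (if partner c i < i then \<delta> k (partner c i) - \<delta> k i else 0)"
| "half_dual k (ColB c) (CycB i) = (if i < partner c i then \<delta> k i - \<delta> k (partner c i) else \<delta> k (partner c i))"
| "half_dual k _ _ = 0"

definition dual :: "nat \<Rightarrow> vtx \<Rightarrow> vtx \<Rightarrow> int" where
  "dual k x y = half_dual k x y - half_dual k y x"

text \<open>Values must depend on the edge alone, not on its torus. In \<open>half_dual\<close> the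
  case \<open>i \<le> j\<close> covers both the generator edge, where i = j, and the torus edge from
  \<open>CycA i\<close> to \<open>CycB j\<close> with class a_i; \<open>max\<close> occurs because
  both \<open>CycA i\<close> and \<open>CycA j\<close> reach \<open>ColA\<close> along edges of
  class a_j when i < j.\<close>

lemma dual_triangle:
  assumes xyz: "(x, y, z) \<in> triangles" and uvw: "u \<in> {x, y, z}" "v \<in> {x, y, z}" "w \<in> {x, y, z}"
  shows "dual k u v + dual k v w = dual k u w"
proof -
  have anti: "dual k a b = - dual k b a" "dual k a a = 0" for a b
    by (simp_all add: dual_def)
  \<comment> \<open>One ordering of the triangle is enough; antisymmetry supplies the others and the
    degenerate choices.\<close>
  have "dual k x y + dual k y z = dual k x z"
    using xyz
  proof (cases rule: trianglesE)
    case (1 i j)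
    then have p: "partner (col i j) i = j" "partner (col i j) j = i"
      using partner_col[of i j] by auto
    show ?thesis
      using 1(1,3) unfolding torus_def insert_iff empty_iff
      by (elim disjE; clarsimp simp: dual_def p)
  qed (auto simp: dual_def)
  then show ?thesis
    using uvw anti(1)[of y x] anti(1)[of z y] anti(1)[of z x] by (elim insertE emptyE) (simp_all add: anti(2))
qed

definition dual_nat :: "nat \<Rightarrow> nat \<Rightarrow> nat \<Rightarrow> int" where
  "dual_nat k u v = dual k (from_nat u) (from_nat v)"

lemma dual_cocycle: "cocycle (dual_nat k)"
  unfolding cocycle_def
proof (intro allI impI)
  fix u v w assume "{u, v, w} \<in> K"
  then obtain F where F: "F \<in> faces" "{u, v, w} = to_nat ` F"
    by (auto simp: K_def)
  then obtain x y z where xyz: "(x, y, z) \<in> triangles" "F \<subseteq> {x, y, z}"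
    by (auto simp: faces_def)
  have "from_nat a \<in> {x, y, z}" if "a \<in> {u, v, w}" for a
    using that xyz(2) unfolding F(2) by auto
  then show "dual_nat k u v + dual_nat k v w = dual_nat k u w"
    unfolding dual_nat_def by (intro dual_triangle[OF xyz(1)]) auto
qed

section \<open>Generators of the glued complex\<close>

abbreviation gen :: "nat \<Rightarrow> (real \<Rightarrow> nat \<Rightarrow> real) set" where
  "gen i \<equiv> edge_class (to_nat (CycA i)) (to_nat (CycB i))"

lemma gen_edge: "i < m \<Longrightarrow> {to_nat (CycA i), to_nat (CycB i)} \<in> K"
  using triangle_face[of "CycA i" "CycB i" "CycB i"] by (auto simp: triangles_def)

lemma pair_torus_face:
  assumes "i < j" "j < m"
    and "(x, y, z) \<in> torus (to_nat Base) (to_nat (ColB (col i j))) (to_nat (CycA j)) (to_nat (CycA i))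
      (to_nat (CycB j)) (to_nat (ColA (col i j))) (to_nat (CycB i))"
  shows "{x, y, z} \<in> K"
proof -
  have "\<exists>x' y' z'. (x', y', z') \<in> pair_torus i j \<and> x = to_nat x' \<and> y = to_nat y' \<and> z = to_nat z'"
    using assms(3) unfolding torus_def by fastforce
  then obtain x' y' z' where "(x', y', z') \<in> pair_torus i j" "x = to_nat x'" "y = to_nat y'" "z = to_nat z'"
    by blast
  then show ?thesis
    using assms(1,2) by (auto intro!: triangle_face simp: triangles_def)
qed

lemma gen_commute:
  assumes "i < m" "j < m"
  shows "gen i \<otimes>\<^bsub>pi1\<^esub> gen j = gen j \<otimes>\<^bsub>pi1\<^esub> gen i"
proof -
  have *: "gen i \<otimes>\<^bsub>pi1\<^esub> gen j = gen j \<otimes>\<^bsub>pi1\<^esub> gen i" if "i < j" "j < m" for i j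
    by (rule torus_commute, erule pair_torus_face[OF that])
  then show ?thesis
    using assms by (cases i j rule: linorder_cases) auto
qed

lemma gens_generate:
  assumes H: "subgroup H pi1" and gens: "\<And>i. i < m \<Longrightarrow> gen i \<in> H"
  shows "H = carrier pi1"
proof (rule edge_classes_generate[OF H])
  fix u v assume "{u, v} \<in> K"
  then obtain F where F: "F \<in> faces" "{u, v} = to_nat ` F"
    by (auto simp: K_def)
  then obtain x y z where xyz: "(x, y, z) \<in> triangles" "F \<subseteq> {x, y, z}"
    by (auto simp: faces_def)
  have "{u, v} \<subseteq> to_nat ` {x, y, z}"
    unfolding F(2) using xyz(2) by blast
  then have uv: "u \<in> {to_nat x, to_nat y, to_nat z}" "v \<in> {to_nat x, to_nat y, to_nat z}"
    by auto
  note K = triangle_face[OF xyz(1)]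
  show "edge_class u v \<in> H"
    using xyz(1)
  proof (cases rule: trianglesE)
    case (1 i j)
    then have T: "(to_nat x, to_nat y, to_nat z) \<in> torus (to_nat Base) (to_nat (ColB (col i j)))
      (to_nat (CycA j)) (to_nat (CycA i)) (to_nat (CycB j)) (to_nat (ColA (col i j))) (to_nat (CycB i))"
      unfolding torus_def by auto
    show ?thesis
      by (rule torus_subgroup[OF _ H _ _ T uv], erule pair_torus_face[OF 1(1,2)]) (use 1 gens in auto)
  next
    case (2 v)
    then show ?thesis
      using edge_class_link[OF K _ uv] subgroup.one_closed[OF H] by simp
  next
    case (3 i)
    have "to_nat (CycB i) \<in> V"
      using 3 face_subset[OF K] by auto
    then show ?thesis
      using triangle_in_subgroup[OF H K _ _ uv] 3 gens edge_class_refl subgroup.one_closed[OF H] by simp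
  qed
qed

lemma has_complex: "has_complex_with_pi1_Zpow (1 + 2 * m + 2 * C) m"
proof -
  have "\<exists>h\<in>hom pi1 integer_group. \<forall>u v. {u, v} \<in> K \<longrightarrow> h (edge_class u v) = dual_nat k u v" for k
    \<comment> \<open>The dual vanishes on edges at \<open>Base\<close> because these fall under the
      default clause of \<open>half_dual\<close>.\<close>
    by (intro cocycle_hom dual_cocycle) (auto simp: V_def dual_nat_def dual_def elim: vtx.exhaust)
  then obtain h where h: "\<And>k. h k \<in> hom pi1 integer_group"
    "\<And>k u v. {u, v} \<in> K \<Longrightarrow> h k (edge_class u v) = dual_nat k u v"
    by metis
  have "pi1 \<cong> Zpow m"
  proof (rule iso_Zpow[of _ _ gen h])
    show "h k (gen i) = (if i = k then 1 else 0)" if "i < m" "k < m" for i k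
      using h(2)[OF gen_edge[OF that(1)]] by (simp add: dual_nat_def dual_def \<delta>_def)
  qed (use group_pi1 edge_class_closed[OF gen_edge] gen_commute gens_generate h(1) in auto)
  moreover have "card V = 1 + 2 * m + 2 * C"
    by (simp add: V_def card_image card_verts)
  ultimately show ?thesis
    unfolding has_complex_with_pi1_Zpow_def
    using simplicial_complex_VK vertex_point_in[OF root_in] by blast
qed

end

section \<open>Proper edge colourings of complete graphs\<close>

lemma add_mod_cancel:
  fixes m :: nat
  assumes "j < m" "k < m" "(i + j) mod m = (i + k) mod m"
  shows "j = k"
proof -
  have "[j = k] (mod m)"
    using assms(3) by (simp add: cong_def[symmetric] cong_add_lcancel_nat)
  then show ?thesis
    using assms by (simp add: cong_def)
qed

text \<open>Cancellation modulo \<open>m\<close> makes this proper for every \<open>m\<close>; the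
  linear bound uses it in both parities.\<close>

lemma odd_colouring: "edge_colouring m m (\<lambda>i j. (i + j) mod m)"
  by unfold_locales (auto simp: add.commute intro: add_mod_cancel)

text \<open>In the colouring by sums, vertex j meets every colour except 2 j mod m, which would
  require j itself as neighbour. The extra vertex uses this missing colour at j, and oddness makes
  doubling injective, so the extra vertex sees no colour twice.\<close>

lemma even_colouring:
  assumes "odd m"
  shows "edge_colouring (m + 1) m (\<lambda>i j. if i = m then (2 * j) mod m else if j = m then (2 * i) mod m else (i + j) mod m)"
proof
  have double: "j = k" if "j < m" "k < m" "(2 * j) mod m = (2 * k) mod m" for j k
  proof -
    have "[2 * j = 2 * k] (mod m)"
      using that by (simp add: cong_def)
    then have "[j = k] (mod m)"
      using assms cong_mult_lcancel_nat[of 2 m] by (simp add: coprime_left_2_iff_odd)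
    then show ?thesis
      using that by (simp add: cong_def)
  qed
  fix i j k :: nat
  assume *: "i < m + 1" "j < m + 1" "k < m + 1" "i \<noteq> j" "i \<noteq> k"
    "(if i = m then (2 * j) mod m else if j = m then (2 * i) mod m else (i + j) mod m) =
     (if i = m then (2 * k) mod m else if k = m then (2 * i) mod m else (i + k) mod m)"
  then show "j = k"
    \<comment> \<open>A clash at \<open>i\<close> between the extra vertex and an ordinary one would
      equate 2 i with i + k or i + j modulo \<open>m\<close>, so that the other end would be
      \<open>i\<close> itself.\<close>
    using add_mod_cancel[of j m k i] add_mod_cancel[of i m k i] add_mod_cancel[of j m i i] double[of j k]
    by (auto split: if_splits simp: mult_2)
qed (use assms odd_pos in \<open>auto simp: add.commute\<close>)

theorem mainTheorem5:
  shows "(\<forall>n::nat. n \<ge> 1 \<and> n \<noteq> 2 \<and> n \<noteq> 3 \<longrightarrow>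
            has_complex_with_pi1_Zpow (8*n - 1) (2*n) \<and>
            has_complex_with_pi1_Zpow (8*n - 3) (2*n - 1)) \<and>
         (\<exists>C::nat. \<forall>m::nat. \<exists>N. N \<le> C * (m + 1) \<and> has_complex_with_pi1_Zpow N m)"
proof (intro conjI allI impI)
  fix n :: nat assume n: "n \<ge> 1 \<and> n \<noteq> 2 \<and> n \<noteq> 3"
  \<comment> \<open>Even rank adds one vertex to the complete graph on 2n - 1 vertices without a new
    colour. Positivity of \<open>n\<close> keeps the truncated subtractions exact.\<close>
  have "1 + 2 * (2 * n - 1 + 1) + 2 * (2 * n - 1) = 8 * n - 1" "2 * n - 1 + 1 = 2 * n" "odd (2 * n - 1)"
    "1 + 2 * (2 * n - 1) + 2 * (2 * n - 1) = 8 * n - 3"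
    using n by auto
  then show "has_complex_with_pi1_Zpow (8*n - 1) (2*n)" "has_complex_with_pi1_Zpow (8*n - 3) (2*n - 1)"
    using edge_colouring.has_complex[OF even_colouring[of "2 * n - 1"]]
      edge_colouring.has_complex[OF odd_colouring[of "2 * n - 1"]] by simp_all
next
  show "\<exists>C::nat. \<forall>m::nat. \<exists>N. N \<le> C * (m + 1) \<and> has_complex_with_pi1_Zpow N m"
    using edge_colouring.has_complex[OF odd_colouring]
    \<comment> \<open>With \<open>m\<close> colours there are 4m + 1 vertices, at most 4 (m + 1);
      the summand 1 is needed since rank 0 still has a base vertex.\<close>
    by (intro exI[of _ 4] allI exI[of _ "1 + 2 * m + 2 * m" for m] conjI) auto
qed

end
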